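(* Let $(\mathcal S,\mathcal A,\lambda)$ be the mixture measure space of a finite or countable family of disjoint $\sigma$-finite measure spaces $(\mathcal S_i,\mathcal A_i,\lambda_i)_{i\in\mathcal D}$, let $\pi$ be a probability measure on $(\mathcal S,\mathcal A)$ with density $p$ w.r.t. $\lambda$, and let $\mathcal M$ be a finite or countable set of moves with move probabilities $q_\ell$ and a bijection $r:\mathcal M\to\mathcal M$, $\ell\mapsto r_\ell$, where $r_\ell$ stands for the unique backward move of $\ell$. Suppose the moves are ad-hoc translations: for a move $\ell$ from $\mathcal S_j$ to $\mathcal S_i$ there are a measurable function $\mathbf s_\ell:\mathcal S_j\to\mathcal S_i$ and a kernel density $k_\ell$ from $(\mathcal S_i,\mathcal A_i)$ to $(\mathcal S_i,\mathcal A_i,\lambda_i)$, and the proposal of move $\ell$ is $K_\ell(s',\cdot)=\int_{\cdot}k_\ell(\mathbf s_\ell(s'),s)\,\lambda_i(ds)$ for $s'\in\mathcal S_j$. Then the transition kernel $$\mu(s',\cdot)=\sum_{\ell\in\mathcal M}q_\ell(s')\int \Big( a^\ell_{s's}\,\delta_s(\cdot)+\big(1-a^\ell_{s's}\big)\delta_{s'}(\cdot)\Big)K_\ell(s',ds)$$ with acceptance probability $$a^\ell_{s's}=\min\left\{1,\ \frac{p(s)\,k_{r_\ell}(\mathbf s_{r_\ell}(s),s')}{p(s')\,k_\ell(\mathbf s_\ell(s'),s)}\cdot\frac{q_{r_\ell}(s)}{q_\ell(s')}\right\}$$ preserves the detailed balance condition w.r.t. $\pi$.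
   Context: Mixture measure space: $\mathcal D$ is a finite or countable set, $(\mathcal S_i,\mathcal A_i,\lambda_i)_{i\in\mathcal D}$ are $\sigma$-finite measure spaces with pairwise disjoint $\mathcal S_i$; $\mathcal S=\bigcup_{i}\mathcal S_i$, $\mathcal A=\sigma(\bigcup_i\mathcal A_i)$, $\lambda=\sum_{i}\lambda_i\circ\mathrm{id}_i^{-1}$, where $\mathrm{id}_i:\mathcal S_i\to\mathcal S$ is the inclusion. Moves: each move $\ell\in\mathcal M$ transitions between a pair of the spaces, from $\mathcal S_j$ to $\mathcal S_i$ (both depending on $\ell$); if $\ell$ transitions from $\mathcal S_j$ to $\mathcal S_i$, its backward move $r_\ell$ should transition from $\mathcal S_i$ to $\mathcal S_j$. The move probabilities $q_\ell:\mathcal S\to[0,1]$ are measurable with $\sum_{\ell\in\mathcal M}q_\ell(s')=1$ for all $s'\in\mathcal S$. The proposal density $(s',s)\mapsto k_\ell(\mathbf s_\ell(s'),s)$ of a move is lifted to $\mathcal S\times\mathcal S$ by setting it to $0$ for unsupported arguments. Kernel density from $(\mathcal S_i,\mathcal A_i)$ to $(\mathcal S_i,\mathcal A_i,\lambda_i)$: a jointly measurable $k_\ell:\mathcal S_i\times\mathcal S_i\to[0,\infty)$ with $\int k_\ell(x,s)\lambda_i(ds)=1$ for all $x\in\mathcal S_i$. Convention: an acceptance probability is set to $0$ wherever its defining expression is not defined. Detailed balance: a Markov kernel $\mu$ on $(\mathcal S,\mathcal A)$ preserves the detailed balance condition w.r.t. $\pi$ if $\pi\otimes\mu(A\times B)=\pi\otimes\mu(B\times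 A)$ for all $A,B\in\mathcal A$, where $\pi\otimes\mu(A\times B)=\int_A\mu(s',B)\,\pi(ds')$. *)

theory Defs
  imports "HOL-Probability.Probability"
begin

text \<open>
  Series of extended nonnegative reals over a countable index set are written as integrals
  with respect to the counting measure. The spaces of the family are disjoint subsets of a
  common type, so the inclusions of the components into the mixture are identity maps.
\<close>

definition mixture_measure :: "'i set \<Rightarrow> ('i \<Rightarrow> 'a measure) \<Rightarrow> 'a measure" where
  "mixture_measure D L =
     measure_of (\<Union>i\<in>D. space (L i)) (\<Union>i\<in>D. sets (L i))
       (\<lambda>A. \<integral>\<^sup>+ i. emeasure (L i) (A \<inter> space (L i)) \<partial>count_space D)"

definition kernel_density :: "'a measure \<Rightarrow> 'b measure \<Rightarrow> ('a \<Rightarrow> 'b \<Rightarrow> real) \<Rightarrow> bool" where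
  "kernel_density X Y k \<longleftrightarrow>
     (\<lambda>(x, y). k x y) \<in> borel_measurable (X \<Otimes>\<^sub>M Y) \<and>
     (\<forall>x\<in>space X. \<forall>y\<in>space Y. 0 \<le> k x y) \<and>
     (\<forall>x\<in>space X. (\<integral>\<^sup>+ y. ennreal (k x y) \<partial>Y) = 1)"

text \<open>
  The proposal density of a single ad-hoc move from the space \<open>X\<close> to the space \<open>Y\<close> with
  translation function \<open>t\<close> and kernel density \<open>k\<close>, set to 0 for unsupported arguments.
\<close>

definition lifted_density ::
  "'a measure \<Rightarrow> 'a measure \<Rightarrow> ('a \<Rightarrow> 'a) \<Rightarrow> ('a \<Rightarrow> 'a \<Rightarrow> real) \<Rightarrow> 'a \<Rightarrow> 'a \<Rightarrow> real" where
  "lifted_density X Y t k s' s =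
     (if s' \<in> space X \<and> s \<in> space Y then k (t s') s else 0)"

text \<open>
  The proposal kernel of that move, as a measure on the mixture space \<open>S\<close>: the push-forward
  along the inclusion of \<open>Y\<close>. It is the null measure for \<open>s'\<close> outside \<open>X\<close>.
\<close>

definition adhoc_proposal ::
  "'a measure \<Rightarrow> 'a measure \<Rightarrow> 'a measure \<Rightarrow> ('a \<Rightarrow> 'a) \<Rightarrow> ('a \<Rightarrow> 'a \<Rightarrow> real) \<Rightarrow> 'a \<Rightarrow> 'a measure" where
  "adhoc_proposal S X Y t k s' =
     distr (density Y (\<lambda>s. ennreal (lifted_density X Y t k s' s))) S (\<lambda>s. s)"

text \<open>Here \<open>kd l s' s\<close> stands for the lifted proposal density of the move \<open>l\<close>; the
  first branch covers the arguments where the quotient is undefined.\<close>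

definition acceptance ::
  "('a \<Rightarrow> real) \<Rightarrow> ('m \<Rightarrow> 'a \<Rightarrow> real) \<Rightarrow> ('m \<Rightarrow> 'm) \<Rightarrow> ('m \<Rightarrow> 'a \<Rightarrow> 'a \<Rightarrow> real) \<Rightarrow> 'm \<Rightarrow> 'a \<Rightarrow> 'a \<Rightarrow> real" where
  "acceptance p q r kd l s' s =
     (if p s' * kd l s' s = 0 \<or> q l s' = 0 then 0
      else min 1 ((p s * kd (r l) s s') / (p s' * kd l s' s) * (q (r l) s / q l s')))"

definition transition_kernel ::
  "'a measure \<Rightarrow> 'm set \<Rightarrow> ('m \<Rightarrow> 'a \<Rightarrow> real) \<Rightarrow> ('m \<Rightarrow> 'a \<Rightarrow> 'a \<Rightarrow> real) \<Rightarrow>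
   ('m \<Rightarrow> 'a \<Rightarrow> 'a measure) \<Rightarrow> 'a \<Rightarrow> 'a measure" where
  "transition_kernel S M q a K s' =
     measure_of (space S) (sets S)
       (\<lambda>B. \<integral>\<^sup>+ l. ennreal (q l s') *
              (\<integral>\<^sup>+ s. ennreal (a l s' s) * emeasure (return S s) B +
                     ennreal (1 - a l s' s) * emeasure (return S s') B \<partial>K l s')
            \<partial>count_space M)"

definition markov_kernel :: "'a measure \<Rightarrow> ('a \<Rightarrow> 'a measure) \<Rightarrow> bool" where
  "markov_kernel S \<mu> \<longleftrightarrow> \<mu> \<in> S \<rightarrow>\<^sub>M prob_algebra S"

text \<open>The value of the product \<open>\<pi> \<otimes> \<mu>\<close> on the rectangle with sides \<open>A\<close> and \<open>B\<close>.\<close>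

definition kernel_product :: "'a measure \<Rightarrow> ('a \<Rightarrow> 'a measure) \<Rightarrow> 'a set \<Rightarrow> 'a set \<Rightarrow> ennreal" where
  "kernel_product \<pi> \<mu> A B = (\<integral>\<^sup>+ s'\<in>A. emeasure (\<mu> s') B \<partial>\<pi>)"

definition detailed_balance :: "'a measure \<Rightarrow> ('a \<Rightarrow> 'a measure) \<Rightarrow> bool" where
  "detailed_balance \<pi> \<mu> \<longleftrightarrow>
     (\<forall>A\<in>sets \<pi>. \<forall>B\<in>sets \<pi>. kernel_product \<pi> \<mu> A B = kernel_product \<pi> \<mu> B A)"

end

theory Submission
  imports Defs
begin

text \<open>
  The proposal kernels of ad-hoc moves all have densities with respect to the one
  \<open>\<sigma>\<close>-finite measure \<open>S\<close>. Multiplying the acceptance probability by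
  \<open>p s' * q l s' * kd l s' s\<close> gives the minimum of this product and the one of the
  backward move with \<open>s\<close> and \<open>s'\<close> exchanged, including the arguments where the quotient is
  undefined. So the accepted part of move \<open>l\<close> from \<open>A\<close> to \<open>B\<close> is that of \<open>r l\<close> from \<open>B\<close>
  to \<open>A\<close> by Tonelli, and the sum over all moves is symmetric since \<open>r\<close> permutes them. The
  rejected part depends only on \<open>A \<inter> B\<close>.
\<close>

section \<open>Sums over countable index sets as integrals\<close>

lemma borel_measurable_nn_integral_count_space:
  fixes f :: "'i \<Rightarrow> 'a \<Rightarrow> ennreal"
  assumes "countable I" and "\<And>i. i \<in> I \<Longrightarrow> f i \<in> borel_measurable N"
  shows "(\<lambda>x. \<integral>\<^sup>+ i. f i x \<partial>count_space I) \<in> borel_measurable N"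
proof -
  interpret sigma_finite_measure "count_space I"
    using assms(1) by (rule sigma_finite_measure_count_space_countable)
  have "(\<lambda>(i, x). f i x) \<in> borel_measurable (count_space I \<Otimes>\<^sub>M N)"
    using assms by (intro measurable_pair_measure_countable1) auto
  then have "(\<lambda>(x, i). f i x) \<in> borel_measurable (N \<Otimes>\<^sub>M count_space I)"
    by (subst measurable_pair_swap_iff) (simp add: case_prod_beta)
  then show ?thesis by (rule borel_measurable_nn_integral)
qed

text \<open>Tonelli: the counting measure on a countable index set is
  \<open>\<sigma>\<close>-finite, so the sum over all moves can be exchanged with the integral over
  the state space.\<close>

lemma (in sigma_finite_measure) nn_integral_count_space_swap:
  fixes f :: "'i \<Rightarrow> 'a \<Rightarrow> ennreal"
  assumes "countable I" and "\<And>i. i \<in> I \<Longrightarrow> f i \<in> borel_measurable M"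
  shows "(\<integral>\<^sup>+ x. (\<integral>\<^sup>+ i. f i x \<partial>count_space I) \<partial>M) = (\<integral>\<^sup>+ i. (\<integral>\<^sup>+ x. f i x \<partial>M) \<partial>count_space I)"
proof -
  interpret P: pair_sigma_finite "count_space I" M
    using assms(1)
    by (intro pair_sigma_finite.intro sigma_finite_measure_count_space_countable
        sigma_finite_measure_axioms)
  have "(\<lambda>(i, x). f i x) \<in> borel_measurable (count_space I \<Otimes>\<^sub>M M)"
    using assms by (intro measurable_pair_measure_countable1) auto
  then show ?thesis by (rule P.Fubini')
qed

lemma nn_integral_count_space_has_sum:
  fixes f :: "'i \<Rightarrow> real"
  assumes "(f has_sum c) I" and "\<And>i. i \<in> I \<Longrightarrow> 0 \<le> f i"
  shows "(\<integral>\<^sup>+ i. ennreal (f i) \<partial>count_space I) = ennreal c"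
proof -
  \<comment> \<open>Nonnegativity makes the sum absolutely convergent, which gives access to
    \<open>infsetsum\<close>. That sum is an integral over the counting measure, hence comparable
    with the left-hand side.\<close>
  have "f summable_on I" using assms(1) by (rule has_sum_imp_summable)
  then have "(\<lambda>i. norm (f i)) summable_on I"
    using assms(2) by (subst summable_on_cong[of I _ f]) auto
  then have *: "Infinite_Set_Sum.abs_summable_on f I" by (simp only: abs_summable_equivalent)
  then show ?thesis
    using assms nn_integral_conv_infsetsum[OF *] infsetsum_infsum[OF *] infsumI[OF assms(1)]
    by simp
qed

section \<open>Metropolis--Hastings kernels with countably many moves\<close>

lemma acceptance_in_unit_interval:
  assumes "0 \<le> p s" "0 \<le> p s'" "0 \<le> q l s'" "0 \<le> q (r l) s" "0 \<le> kd l s' s" "0 \<le> kd (r l) s s'"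
  shows "acceptance p q r kd l s' s \<in> {0..1}"
  using assms unfolding acceptance_def by (auto simp: min_def)

text \<open>If the quotient is undefined, the forward product is 0 and the backward one is
  nonnegative, so both sides are 0. Otherwise the forward product is positive, can be multiplied
  into the minimum, and cancels the denominators.\<close>

lemma acceptance_times_flux:
  assumes "0 \<le> p s" "0 \<le> p s'" "0 \<le> q l s'" "0 \<le> q (r l) s" "0 \<le> kd l s' s" "0 \<le> kd (r l) s s'"
  shows "p s' * q l s' * kd l s' s * acceptance p q r kd l s' s =
    min (p s' * q l s' * kd l s' s) (p s * q (r l) s * kd (r l) s s')"
proof (cases "p s' * kd l s' s = 0 \<or> q l s' = 0")
  case True
  then show ?thesis using assms by (auto simp: acceptance_def min_def)
next
  case False
  then have pos: "0 < p s' * q l s' * kd l s' s" using assms by (auto simp: less_le)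
  have "p s' * q l s' * kd l s' s * acceptance p q r kd l s' s =
      min (p s' * q l s' * kd l s' s * 1) (p s' * q l s' * kd l s' s *
        ((p s * kd (r l) s s') / (p s' * kd l s' s) * (q (r l) s / q l s')))"
    unfolding acceptance_def using False pos by (auto simp: min_mult_distrib_left)
  also have "p s' * q l s' * kd l s' s *
        ((p s * kd (r l) s s') / (p s' * kd l s' s) * (q (r l) s / q l s'))
      = p s * q (r l) s * kd (r l) s s'"
    using False by (simp add: field_simps)
  finally show ?thesis by simp
qed

text \<open>The setting forgets the mixture and keeps only densities with respect to one
  \<open>\<sigma>\<close>-finite measure. Proposals are merely required to have mass at most 1,
  because a lifted density has mass 0 at points outside the source space of its move.\<close>

locale countable_moves = sigma_finite_measure S for S :: "'a measure" +
  fixes p :: "'a \<Rightarrow> real" and M :: "'m set" and r :: "'m \<Rightarrow> 'm"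
    and q :: "'m \<Rightarrow> 'a \<Rightarrow> real" and kd :: "'m \<Rightarrow> 'a \<Rightarrow> 'a \<Rightarrow> real"
  assumes p_measurable[measurable]: "p \<in> borel_measurable S"
    and p_nonneg: "\<And>s. s \<in> space S \<Longrightarrow> 0 \<le> p s"
    and countable_M: "countable M"
    and r_bij: "bij_betw r M M"
    and r_involution: "\<And>l. l \<in> M \<Longrightarrow> r (r l) = l"
    and q_measurable: "\<And>l. l \<in> M \<Longrightarrow> q l \<in> borel_measurable S"
    and q_nonneg: "\<And>l s'. l \<in> M \<Longrightarrow> s' \<in> space S \<Longrightarrow> 0 \<le> q l s'"
    and q_sum: "\<And>s'. s' \<in> space S \<Longrightarrow> ((\<lambda>l. q l s') has_sum 1) M"
    and kd_measurable:
      "\<And>l. l \<in> M \<Longrightarrow> (\<lambda>(s', s). kd l s' s) \<in> borel_measurable (S \<Otimes>\<^sub>M S)"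
    and kd_nonneg: "\<And>l s' s. l \<in> M \<Longrightarrow> s' \<in> space S \<Longrightarrow> s \<in> space S \<Longrightarrow> 0 \<le> kd l s' s"
    and kd_le_1:
      "\<And>l s'. l \<in> M \<Longrightarrow> s' \<in> space S \<Longrightarrow> (\<integral>\<^sup>+ s. ennreal (kd l s' s) \<partial>S) \<le> 1"
    and space_nonempty: "space S \<noteq> {}"
begin

abbreviation acc :: "'m \<Rightarrow> 'a \<Rightarrow> 'a \<Rightarrow> real" where
  "acc \<equiv> acceptance p q r kd"

text \<open>The same transition kernel, but with proposals given directly as densities on
  \<open>S\<close>; the ad-hoc proposals are identified with such densities later.\<close>

definition \<kappa> :: "'a \<Rightarrow> 'a measure" where
  "\<kappa> = transition_kernel S M q acc (\<lambda>l s'. density S (\<lambda>s. ennreal (kd l s' s)))"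

text \<open>The contribution of one move to \<open>\<kappa>\<close>, before weighting by
  \<open>q\<close>, with the Dirac measures evaluated as indicators and the proposal density moved
  into the integrand.\<close>

definition move_mass :: "'m \<Rightarrow> 'a \<Rightarrow> 'a set \<Rightarrow> ennreal" where
  "move_mass l s' B =
    (\<integral>\<^sup>+ s. ennreal (kd l s' s) * (ennreal (acc l s' s) * indicator B s +
                 ennreal (1 - acc l s' s) * indicator B s') \<partial>S)"

lemma r_in: "l \<in> M \<Longrightarrow> r l \<in> M"
  using r_bij by (auto simp: bij_betw_def)

lemma acc_unit:
  "l \<in> M \<Longrightarrow> s' \<in> space S \<Longrightarrow> s \<in> space S \<Longrightarrow> 0 \<le> acc l s' s \<and> acc l s' s \<le> 1"
  using acceptance_in_unit_interval[of p s s' q l r kd] r_in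
  by (auto simp: p_nonneg q_nonneg kd_nonneg)

section \<open>Measurability of densities, acceptance probabilities and single moves\<close>

lemma measurable_components:
  assumes "l \<in> M"
  shows "q l \<in> borel_measurable S" "(\<lambda>x. kd l (fst x) (snd x)) \<in> borel_measurable (S \<Otimes>\<^sub>M S)"
    "(\<lambda>x. kd l (snd x) (fst x)) \<in> borel_measurable (S \<Otimes>\<^sub>M S)"
    "(\<lambda>x. acc l (fst x) (snd x)) \<in> borel_measurable (S \<Otimes>\<^sub>M S)"
proof -
  note [measurable] = q_measurable[OF assms] q_measurable[OF r_in[OF assms]]
  have kd[measurable]: "(\<lambda>x. kd l (fst x) (snd x)) \<in> borel_measurable (S \<Otimes>\<^sub>M S)" if "l \<in> M" for l
    using kd_measurable[OF that] by (simp add: case_prod_beta)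
  \<comment> \<open>The acceptance probability evaluates the backward density at exchanged
    arguments, so measurability is also needed after a swap of coordinates.\<close>
  have kd'[measurable]: "(\<lambda>x. kd l (snd x) (fst x)) \<in> borel_measurable (S \<Otimes>\<^sub>M S)" if "l \<in> M" for l
    using measurable_compose[OF measurable_pair_swap' kd[OF that]] by (simp add: case_prod_beta)
  note [measurable] = kd[OF assms] kd'[OF r_in[OF assms]]
  show "q l \<in> borel_measurable S" "(\<lambda>x. kd l (fst x) (snd x)) \<in> borel_measurable (S \<Otimes>\<^sub>M S)"
    "(\<lambda>x. kd l (snd x) (fst x)) \<in> borel_measurable (S \<Otimes>\<^sub>M S)"
    using kd'[OF assms] by measurable
  show "(\<lambda>x. acc l (fst x) (snd x)) \<in> borel_measurable (S \<Otimes>\<^sub>M S)"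
    unfolding acceptance_def by measurable
qed

lemma measurable_section:
  assumes "l \<in> M" "s' \<in> space S"
  shows "kd l s' \<in> borel_measurable S" "acc l s' \<in> borel_measurable S"
  using measurable_components(2,4)[OF assms(1), THEN measurable_compose[OF measurable_Pair1'[OF assms(2)]]]
  by simp_all

lemma measurable_move_mass:
  assumes "l \<in> M" and [measurable]: "B \<in> sets S"
  shows "(\<lambda>s'. move_mass l s' B) \<in> borel_measurable S"
  unfolding move_mass_def
  using measurable_components(2,4)[OF assms(1)]
  by (intro borel_measurable_nn_integral) (simp add: case_prod_beta)

lemma \<kappa>_integrand:
  assumes "l \<in> M" "s' \<in> space S" and [measurable]: "B \<in> sets S"
  shows "(\<integral>\<^sup>+ s. ennreal (acc l s' s) * emeasure (return S s) B +
            ennreal (1 - acc l s' s) * emeasure (return S s') B \<partial>density S (\<lambda>s. ennreal (kd l s' s)))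
         = move_mass l s' B"
proof -
  note [measurable] = measurable_section[OF assms(1,2)]
  show ?thesis unfolding move_mass_def
    by (subst nn_integral_density) (auto intro!: nn_integral_cong)
qed

section \<open>The kernel as a family of measures, and its total mass\<close>

lemma space_\<kappa>[simp]: "space (\<kappa> s') = space S" and sets_\<kappa>[simp, measurable_cong]: "sets (\<kappa> s') = sets S"
  by (simp_all add: \<kappa>_def transition_kernel_def)

lemma move_mass_UN:
  assumes l: "l \<in> M" and s': "s' \<in> space S" and A: "range A \<subseteq> sets S" "disjoint_family A"
  shows "move_mass l s' (\<Union>n. A n) = (\<Sum>n. move_mass l s' (A n))"
proof -
  note [measurable] = measurable_section[OF l s']
  have [measurable]: "A n \<in> sets S" for n using A by auto
  have ind: "(indicator (\<Union>n. A n) x :: ennreal) = (\<Sum>n. indicator (A n) x)" for x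
    using A(2) by (rule suminf_indicator[symmetric])
  have split: "ennreal (kd l s' s) * (ennreal (acc l s' s) * indicator (\<Union>n. A n) s +
        ennreal (1 - acc l s' s) * indicator (\<Union>n. A n) s') =
      (\<Sum>n. ennreal (kd l s' s) * (ennreal (acc l s' s) * indicator (A n) s +
        ennreal (1 - acc l s' s) * indicator (A n) s'))" for s
    unfolding ind by (simp add: suminf_add flip: ennreal_suminf_cmult)
  show ?thesis
    unfolding move_mass_def split by (rule nn_integral_suminf) measurable
qed

text \<open>\<open>measure_of\<close> returns the prescribed values only if these form a measure.
  Countable additivity passes from single moves to the sum by exchanging two series of nonnegative
  terms.\<close>

lemma emeasure_\<kappa>:
  assumes s': "s' \<in> space S" and B: "B \<in> sets S"
  shows "emeasure (\<kappa> s') B = (\<integral>\<^sup>+ l. ennreal (q l s') * move_mass l s' B \<partial>count_space M)"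
proof -
  let ?f = "\<lambda>B. \<integral>\<^sup>+ l. ennreal (q l s') *
      (\<integral>\<^sup>+ s. ennreal (acc l s' s) * emeasure (return S s) B +
            ennreal (1 - acc l s' s) * emeasure (return S s') B \<partial>density S (\<lambda>s. ennreal (kd l s' s)))
            \<partial>count_space M"
  \<comment> \<open>The Dirac measures reduce to indicators on measurable sets, so this rewriting is
    restricted to \<open>sets S\<close>.\<close>
  have f: "?f B = (\<integral>\<^sup>+ l. ennreal (q l s') * move_mass l s' B \<partial>count_space M)"
    if "B \<in> sets S" for B
    using that s' by (intro nn_integral_cong) (simp add: \<kappa>_integrand del: emeasure_return)
  have "emeasure (\<kappa> s') B = ?f B"
    unfolding \<kappa>_def transition_kernel_def
  proof (rule emeasure_measure_of_sigma[OF sets.sigma_algebra_axioms _ _ B])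
    show "positive (sets S) ?f" by (simp add: positive_def)
    show "countably_additive (sets S) ?f"
    proof (rule countably_additiveI)
      fix A :: "nat \<Rightarrow> 'a set"
      assume A: "range A \<subseteq> sets S" "disjoint_family A" "(\<Union>n. A n) \<in> sets S"
      have "(\<Sum>n. ?f (A n)) = (\<Sum>n. \<integral>\<^sup>+ l. ennreal (q l s') * move_mass l s' (A n) \<partial>count_space M)"
        using A by (intro suminf_cong f) auto
      also have "\<dots> = (\<integral>\<^sup>+ l. (\<Sum>n. ennreal (q l s') * move_mass l s' (A n)) \<partial>count_space M)"
        by (rule nn_integral_suminf[symmetric]) simp
      also have "\<dots> = (\<integral>\<^sup>+ l. ennreal (q l s') * move_mass l s' (\<Union>n. A n) \<partial>count_space M)"
        using A s' by (intro nn_integral_cong) (simp add: move_mass_UN)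
      also have "\<dots> = ?f (\<Union>n. A n)" using A(3) by (rule f[symmetric])
      finally show "(\<Sum>n. ?f (A n)) = ?f (\<Union>n. A n)" .
    qed
  qed
  then show ?thesis using f[OF B] by simp
qed

text \<open>Acceptance and rejection weights add up to 1, which leaves the mass of the
  proposal.\<close>

lemma move_mass_space:
  assumes l: "l \<in> M" and s': "s' \<in> space S"
  shows "move_mass l s' (space S) = (\<integral>\<^sup>+ s. ennreal (kd l s' s) \<partial>S)"
  unfolding move_mass_def
proof (rule nn_integral_cong)
  fix s assume s: "s \<in> space S"
  have "ennreal (acc l s' s) + ennreal (1 - acc l s' s) = 1"
    using acc_unit[OF l s' s] by (simp flip: ennreal_plus)
  then show "ennreal (kd l s' s) * (ennreal (acc l s' s) * indicator (space S) s +
      ennreal (1 - acc l s' s) * indicator (space S) s') = ennreal (kd l s' s)"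
    using s s' by simp
qed

lemma q_nn_sum: "s' \<in> space S \<Longrightarrow> (\<integral>\<^sup>+ l. ennreal (q l s') \<partial>count_space M) = 1"
  using nn_integral_count_space_has_sum[OF q_sum] q_nonneg by simp

lemma subprob_\<kappa>: "\<kappa> \<in> S \<rightarrow>\<^sub>M subprob_algebra S"
proof (rule measurable_subprob_algebra)
  fix s' assume s': "s' \<in> space S"
  have "emeasure (\<kappa> s') (space S) \<le> (\<integral>\<^sup>+ l. ennreal (q l s') * 1 \<partial>count_space M)"
    unfolding emeasure_\<kappa>[OF s' sets.top]
    using s' by (intro nn_integral_mono mult_left_mono) (auto simp: move_mass_space kd_le_1)
  then show "subprob_space (\<kappa> s')"
    using s' space_nonempty by (intro subprob_spaceI) (auto simp: q_nn_sum)
next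
  fix B assume B: "B \<in> sets S"
  have "(\<lambda>s'. \<integral>\<^sup>+ l. ennreal (q l s') * move_mass l s' B \<partial>count_space M) \<in> borel_measurable S"
    using B q_measurable measurable_move_mass
    by (intro borel_measurable_nn_integral_count_space countable_M) auto
  then show "(\<lambda>s'. emeasure (\<kappa> s') B) \<in> borel_measurable S"
    using B by (subst measurable_cong[OF emeasure_\<kappa>])
qed simp

text \<open>Full proposal mass is demanded only where \<open>q l s'\<close> is nonzero, since other
  moves contribute nothing. The total mass is then the sum of the move probabilities.\<close>

lemma markov_\<kappa>:
  assumes "\<And>l s'. l \<in> M \<Longrightarrow> s' \<in> space S \<Longrightarrow> q l s' \<noteq> 0 \<Longrightarrow>
    (\<integral>\<^sup>+ s. ennreal (kd l s' s) \<partial>S) = 1"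
  shows "markov_kernel S \<kappa>"
  unfolding markov_kernel_def
proof (rule measurable_prob_algebraI[OF _ subprob_\<kappa>])
  fix s' assume s': "s' \<in> space S"
  have "emeasure (\<kappa> s') (space S) = (\<integral>\<^sup>+ l. ennreal (q l s') \<partial>count_space M)"
    unfolding emeasure_\<kappa>[OF s' sets.top]
  proof (rule nn_integral_cong)
    fix l assume "l \<in> space (count_space M)"
    then show "ennreal (q l s') * move_mass l s' (space S) = ennreal (q l s')"
      using s' assms by (cases "q l s' = 0") (auto simp: move_mass_space)
  qed
  then show "prob_space (\<kappa> s')" using s' by (intro prob_spaceI) (simp add: q_nn_sum)
qed

section \<open>Accepted and rejected flow, and detailed balance\<close>

definition accepted :: "'m \<Rightarrow> 'a set \<Rightarrow> 'a set \<Rightarrow> ennreal" where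
  "accepted l A B = (\<integral>\<^sup>+ s'. (\<integral>\<^sup>+ s.
     ennreal (min (p s' * q l s' * kd l s' s) (p s * q (r l) s * kd (r l) s s')) *
     (indicator A s' * indicator B s) \<partial>S) \<partial>S)"

text \<open>A single set suffices: a rejected proposal leaves the state at \<open>s'\<close>, so
  start and end point satisfy their conditions together.\<close>

definition rejected :: "'m \<Rightarrow> 'a set \<Rightarrow> ennreal" where
  "rejected l A = (\<integral>\<^sup>+ s'. (\<integral>\<^sup>+ s.
     ennreal (p s' * q l s' * kd l s' s * (1 - acc l s' s)) * indicator A s' \<partial>S) \<partial>S)"

text \<open>Replacing \<open>l\<close> by \<open>r l\<close> and exchanging \<open>s'\<close> with
  \<open>s\<close> only swaps the two entries of the minimum, because \<open>r (r l) = l\<close>.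
  Tonelli restores the order of integration.\<close>

lemma accepted_sym:
  assumes l: "l \<in> M" and [measurable]: "A \<in> sets S" "B \<in> sets S"
  shows "accepted (r l) A B = accepted l B A"
proof -
  interpret P: pair_sigma_finite S S ..
  note [measurable] = measurable_components[OF l] measurable_components[OF r_in[OF l]]
  have "accepted (r l) A B = (\<integral>\<^sup>+ s. (\<integral>\<^sup>+ s'.
     ennreal (min (p s' * q (r l) s' * kd (r l) s' s) (p s * q l s * kd l s s')) *
     (indicator A s' * indicator B s) \<partial>S) \<partial>S)"
    unfolding accepted_def r_involution[OF l]
    by (rule P.Fubini') (simp add: case_prod_beta)
  then show ?thesis unfolding accepted_def by (simp add: min.commute mult.commute)
qed

lemma flux_split:
  assumes l: "l \<in> M" and [measurable]: "A \<in> sets S" "B \<in> sets S"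
  shows "(\<integral>\<^sup>+ s'. ennreal (p s') * (ennreal (q l s') * move_mass l s' B * indicator A s') \<partial>S)
    = accepted l A B + rejected l (A \<inter> B)"
proof -
  note [measurable] = measurable_components[OF l] measurable_components[OF r_in[OF l]]
  let ?f = "\<lambda>s' s. ennreal (min (p s' * q l s' * kd l s' s) (p s * q (r l) s * kd (r l) s s')) *
     (indicator A s' * indicator B s)"
  let ?g = "\<lambda>s' s. ennreal (p s' * q l s' * kd l s' s * (1 - acc l s' s)) * indicator (A \<inter> B) s'"
  have meas: "case_prod ?f \<in> borel_measurable (S \<Otimes>\<^sub>M S)" "case_prod ?g \<in> borel_measurable (S \<Otimes>\<^sub>M S)"
    by (simp_all add: case_prod_beta)
  have sect: "(\<lambda>s. ?f s' s) \<in> borel_measurable S" "(\<lambda>s. ?g s' s) \<in> borel_measurable S"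
    if "s' \<in> space S" for s'
    using meas[THEN measurable_compose[OF measurable_Pair1'[OF that]]] by simp_all
  have "ennreal (p s') * (ennreal (q l s') * move_mass l s' B * indicator A s')
      = (\<integral>\<^sup>+ s. ?f s' s \<partial>S) + (\<integral>\<^sup>+ s. ?g s' s \<partial>S)" if s': "s' \<in> space S" for s'
  proof -
    note [measurable] = measurable_section[OF l s']
    have "ennreal (p s') * (ennreal (q l s') * move_mass l s' B * indicator A s') =
      (ennreal (p s') * ennreal (q l s') * indicator A s') * move_mass l s' B"
      by (simp add: ac_simps)
    also have "\<dots> = (\<integral>\<^sup>+ s. (ennreal (p s') * ennreal (q l s') * indicator A s') *
        (ennreal (kd l s' s) * (ennreal (acc l s' s) * indicator B s +
                 ennreal (1 - acc l s' s) * indicator B s')) \<partial>S)"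
      unfolding move_mass_def by (rule nn_integral_cmult[symmetric]) measurable
    also have "\<dots> = (\<integral>\<^sup>+ s. ?f s' s + ?g s' s \<partial>S)"
    proof (rule nn_integral_cong)
      fix s assume s: "s \<in> space S"
      \<comment> \<open>This turns the minimum in \<open>?f\<close> back into a product with
        \<open>acc\<close>. What remains is distributivity, with \<open>ennreal\<close>
        multiplicative on nonnegative factors and the two indicators at \<open>s'\<close> merging
        into that of \<open>A \<inter> B\<close>.\<close>
      have flux: "min (p s' * q l s' * kd l s' s) (p s * q (r l) s * kd (r l) s s')
          = p s' * q l s' * kd l s' s * acc l s' s"
        using acceptance_times_flux[of p s s' q l r kd] l s s' r_in
        by (simp add: p_nonneg q_nonneg kd_nonneg)
      show "(ennreal (p s') * ennreal (q l s') * indicator A s') *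
        (ennreal (kd l s' s) * (ennreal (acc l s' s) * indicator B s +
                 ennreal (1 - acc l s' s) * indicator B s')) = ?f s' s + ?g s' s"
        unfolding flux
        using acc_unit[OF l s' s] p_nonneg[OF s'] q_nonneg[OF l s'] kd_nonneg[OF l s' s]
        by (auto simp: ennreal_mult distrib_left indicator_def ac_simps)
    qed
    also have "\<dots> = (\<integral>\<^sup>+ s. ?f s' s \<partial>S) + (\<integral>\<^sup>+ s. ?g s' s \<partial>S)"
      using sect[OF s'] by (rule nn_integral_add)
    finally show ?thesis .
  qed
  then have "(\<integral>\<^sup>+ s'. ennreal (p s') * (ennreal (q l s') * move_mass l s' B * indicator A s') \<partial>S)
    = (\<integral>\<^sup>+ s'. (\<integral>\<^sup>+ s. ?f s' s \<partial>S) + (\<integral>\<^sup>+ s. ?g s' s \<partial>S) \<partial>S)"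
    by (rule nn_integral_cong)
  also have "\<dots> = accepted l A B + rejected l (A \<inter> B)"
    unfolding accepted_def rejected_def
    using meas[THEN borel_measurable_nn_integral] by (rule nn_integral_add)
  finally show ?thesis .
qed

lemma kernel_product_\<kappa>:
  assumes [measurable]: "A \<in> sets S" "B \<in> sets S"
  shows "kernel_product (density S (\<lambda>s. ennreal (p s))) \<kappa> A B =
    (\<integral>\<^sup>+ l. accepted l A B \<partial>count_space M) + (\<integral>\<^sup>+ l. rejected l (A \<inter> B) \<partial>count_space M)"
proof -
  have [measurable]: "(\<lambda>s'. emeasure (\<kappa> s') B) \<in> borel_measurable S"
    using measurable_emeasure_kernel[OF subprob_\<kappa>] by simp
  have "kernel_product (density S (\<lambda>s. ennreal (p s))) \<kappa> A B =
      (\<integral>\<^sup>+ s'. ennreal (p s') * (emeasure (\<kappa> s') B * indicator A s') \<partial>S)"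
    unfolding kernel_product_def by (rule nn_integral_density) measurable
  also have "\<dots> = (\<integral>\<^sup>+ s'. (\<integral>\<^sup>+ l. ennreal (p s') * (ennreal (q l s') * move_mass l s' B * indicator A s')
      \<partial>count_space M) \<partial>S)"
    by (intro nn_integral_cong)
      (simp add: emeasure_\<kappa> nn_integral_cmult nn_integral_multc)
  also have "\<dots> = (\<integral>\<^sup>+ l. (\<integral>\<^sup>+ s'. ennreal (p s') * (ennreal (q l s') * move_mass l s' B * indicator A s')
      \<partial>S) \<partial>count_space M)"
    using q_measurable measurable_move_mass[of _ B]
    by (intro nn_integral_count_space_swap countable_M) auto
  also have "\<dots> = (\<integral>\<^sup>+ l. accepted l A B + rejected l (A \<inter> B) \<partial>count_space M)"
    by (intro nn_integral_cong flux_split) auto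
  also have "\<dots> = (\<integral>\<^sup>+ l. accepted l A B \<partial>count_space M) + (\<integral>\<^sup>+ l. rejected l (A \<inter> B) \<partial>count_space M)"
    by (rule nn_integral_add) auto
  finally show ?thesis .
qed

lemma detailed_balance_\<kappa>: "detailed_balance (density S (\<lambda>s. ennreal (p s))) \<kappa>"
  unfolding detailed_balance_def sets_density
proof (intro ballI)
  fix A B assume AB: "A \<in> sets S" "B \<in> sets S"
  \<comment> \<open>Single terms are not symmetric in \<open>A\<close> and \<open>B\<close>;
    reindexing by \<open>r\<close> pairs each move with its backward move, to which
    \<open>accepted_sym\<close> applies.\<close>
  have "(\<integral>\<^sup>+ l. accepted l A B \<partial>count_space M) = (\<integral>\<^sup>+ l. accepted (r l) A B \<partial>count_space M)"
    by (rule nn_integral_bij_count_space[OF r_bij, symmetric])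
  also have "\<dots> = (\<integral>\<^sup>+ l. accepted l B A \<partial>count_space M)"
    using AB by (intro nn_integral_cong) (simp add: accepted_sym)
  finally show "kernel_product (density S (\<lambda>s. ennreal (p s))) \<kappa> A B =
      kernel_product (density S (\<lambda>s. ennreal (p s))) \<kappa> B A"
    using AB by (simp add: kernel_product_\<kappa> Int_commute)
qed

end

section \<open>The mixture measure space\<close>

locale countable_mixture =
  fixes D :: "'i set" and L :: "'i \<Rightarrow> 'a measure"
  assumes countable_D: "countable D"
    and sigma_finite_L: "\<And>i. i \<in> D \<Longrightarrow> sigma_finite_measure (L i)"
    and disjoint: "disjoint_family_on (\<lambda>i. space (L i)) D"
begin

abbreviation S :: "'a measure" where "S \<equiv> mixture_measure D L"

lemma components_subset_Pow: "(\<Union>i\<in>D. sets (L i)) \<subseteq> Pow (\<Union>i\<in>D. space (L i))"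
  using sets.sets_into_space by fast

lemma space_mixture: "space S = (\<Union>i\<in>D. space (L i))"
  unfolding mixture_measure_def by (rule space_measure_of[OF components_subset_Pow])

lemma component_in_mixture: "i \<in> D \<Longrightarrow> A \<in> sets (L i) \<Longrightarrow> A \<in> sets S"
  unfolding mixture_measure_def sets_measure_of[OF components_subset_Pow]
  by (rule sigma_sets.Basic) auto

lemma Int_space_component:
  assumes "i \<in> D" "j \<in> D" "A \<in> sets (L i)"
  shows "A \<inter> space (L j) = (if i = j then A else {})"
  using assms disjoint sets.sets_into_space[OF assms(3)] by (auto simp: disjoint_family_on_def)

text \<open>By disjointness, a generator meets \<open>space (L j)\<close> either in itself or in the
  empty set. Taking traces commutes with complements and countable unions, so the property extends
  to the generated \<open>\<sigma>\<close>-algebra.\<close>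

lemma sets_mixture_Int:
  assumes "j \<in> D" "A \<in> sets S"
  shows "A \<inter> space (L j) \<in> sets (L j)"
  using assms(2) unfolding mixture_measure_def sets_measure_of[OF components_subset_Pow]
proof induction
  case (Basic A)
  then show ?case using Int_space_component[OF _ assms(1)] by auto
next
  case Empty
  then show ?case by simp
next
  case (Compl A)
  have "((\<Union>i\<in>D. space (L i)) - A) \<inter> space (L j) = space (L j) - (A \<inter> space (L j))"
    using assms(1) by auto
  then show ?case using Compl by auto
next
  case (Union A)
  have "(\<Union>n. A n) \<inter> space (L j) = (\<Union>n. A n \<inter> space (L j))" by auto
  then show ?case using Union.IH by (simp only:) (intro sets.countable_UN image_subsetI)
qed

text \<open>The defining set function is countably additive because traces on each component are
  measurable and disjoint, and the sum over \<open>D\<close> commutes with the series.\<close>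

lemma emeasure_mixture:
  assumes "B \<in> sets S"
  shows "emeasure S B = (\<integral>\<^sup>+ i. emeasure (L i) (B \<inter> space (L i)) \<partial>count_space D)"
proof (rule emeasure_measure_of[OF mixture_measure_def components_subset_Pow _ _ assms])
  show "positive (sets S) (\<lambda>A. \<integral>\<^sup>+ i. emeasure (L i) (A \<inter> space (L i)) \<partial>count_space D)"
    by (simp add: positive_def)
  show "countably_additive (sets S) (\<lambda>A. \<integral>\<^sup>+ i. emeasure (L i) (A \<inter> space (L i)) \<partial>count_space D)"
  proof (rule countably_additiveI)
    fix A :: "nat \<Rightarrow> 'a set"
    assume A: "range A \<subseteq> sets S" "disjoint_family A"
    have "(\<Sum>n. \<integral>\<^sup>+ i. emeasure (L i) (A n \<inter> space (L i)) \<partial>count_space D) =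
        (\<integral>\<^sup>+ i. (\<Sum>n. emeasure (L i) (A n \<inter> space (L i))) \<partial>count_space D)"
      by (rule nn_integral_suminf[symmetric]) simp
    also have "\<dots> = (\<integral>\<^sup>+ i. emeasure (L i) ((\<Union>n. A n) \<inter> space (L i)) \<partial>count_space D)"
    proof (rule nn_integral_cong)
      fix i assume "i \<in> space (count_space D)"
      then have "range (\<lambda>n. A n \<inter> space (L i)) \<subseteq> sets (L i)"
        using A sets_mixture_Int by auto
      moreover have "disjoint_family (\<lambda>n. A n \<inter> space (L i))"
        using A(2) by (auto simp: disjoint_family_on_def)
      ultimately have "(\<Sum>n. emeasure (L i) (A n \<inter> space (L i))) =
          emeasure (L i) (\<Union>n. A n \<inter> space (L i))"
        by (rule suminf_emeasure)
      then show "(\<Sum>n. emeasure (L i) (A n \<inter> space (L i))) =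
          emeasure (L i) ((\<Union>n. A n) \<inter> space (L i))"
        by (simp add: Int_UN_distrib2 UN_simps)
    qed
    finally show "(\<Sum>n. \<integral>\<^sup>+ i. emeasure (L i) (A n \<inter> space (L i)) \<partial>count_space D) =
        (\<integral>\<^sup>+ i. emeasure (L i) ((\<Union>n. A n) \<inter> space (L i)) \<partial>count_space D)" .
  qed
qed

lemma emeasure_mixture_component:
  assumes i: "i \<in> D" and A: "A \<in> sets (L i)"
  shows "emeasure S A = emeasure (L i) A"
proof -
  \<comment> \<open>By disjointness only the summand at \<open>j = i\<close> survives.\<close>
  have "emeasure S A = (\<integral>\<^sup>+ j. emeasure (L i) A * indicator {i} j \<partial>count_space D)"
    unfolding emeasure_mixture[OF component_in_mixture[OF assms]]
    using Int_space_component[OF i _ A]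
    by (intro nn_integral_cong) (auto simp: indicator_def)
  also have "\<dots> = emeasure (L i) A"
    using i by (subst nn_integral_cmult_indicator) auto
  finally show ?thesis .
qed

text \<open>This recovers each component from the mixture, so that measurability and integrals can
  be carried between \<open>L i\<close> and \<open>S\<close> by the theory of restricted
  spaces.\<close>

lemma restrict_mixture:
  assumes i: "i \<in> D"
  shows "restrict_space S (space (L i)) = L i"
proof (rule measure_eqI)
  have sp: "space (L i) \<inter> space S \<in> sets S"
    using component_in_mixture[OF i sets.top] by auto
  show sets: "sets (restrict_space S (space (L i))) = sets (L i)"
  proof (intro set_eqI iffI)
    fix A assume "A \<in> sets (restrict_space S (space (L i)))"
    then have "A \<subseteq> space (L i)" "A \<in> sets S" by (simp_all add: sets_restrict_space_iff[OF sp])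
    then show "A \<in> sets (L i)" using sets_mixture_Int[OF i] by (metis inf.absorb1)
  next
    fix A assume A: "A \<in> sets (L i)"
    then show "A \<in> sets (restrict_space S (space (L i)))"
      using component_in_mixture[OF i A] sets.sets_into_space[OF A]
      by (simp add: sets_restrict_space_iff[OF sp])
  qed
  fix A assume "A \<in> sets (restrict_space S (space (L i)))"
  then have A: "A \<in> sets (L i)" by (simp add: sets)
  then show "emeasure (restrict_space S (space (L i))) A = emeasure (L i) A"
    using emeasure_restrict_space[OF sp sets.sets_into_space[OF A]]
    by (simp add: emeasure_mixture_component[OF i])
qed

lemma nn_integral_component:
  assumes "i \<in> D"
  shows "(\<integral>\<^sup>+ s. f s \<partial>L i) = (\<integral>\<^sup>+ s. f s * indicator (space (L i)) s \<partial>S)"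
proof -
  have "space (L i) \<inter> space S \<in> sets S"
    using component_in_mixture[OF assms sets.top] by auto
  then show ?thesis
    using nn_integral_restrict_space[of "space (L i)" S f] by (simp add: restrict_mixture[OF assms])
qed

lemma sigma_finite_mixture: "sigma_finite_measure S"
proof
  have "\<exists>A. countable A \<and> A \<subseteq> sets (L i) \<and> \<Union>A = space (L i) \<and> (\<forall>a\<in>A. emeasure (L i) a \<noteq> \<infinity>)"
    if "i \<in> D" for i
    using sigma_finite_measure.sigma_finite_countable[OF sigma_finite_L[OF that]] by blast
  then obtain A where A: "\<And>i. i \<in> D \<Longrightarrow> countable (A i)" "\<And>i. i \<in> D \<Longrightarrow> A i \<subseteq> sets (L i)"
    "\<And>i. i \<in> D \<Longrightarrow> \<Union>(A i) = space (L i)"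
    "\<And>i a. i \<in> D \<Longrightarrow> a \<in> A i \<Longrightarrow> emeasure (L i) a \<noteq> \<infinity>"
    by metis
  \<comment> \<open>Countable covers of the components by sets of finite measure are pooled; such
    sets keep their measure in the mixture.\<close>
  let ?C = "\<Union>i\<in>D. A i"
  have "countable ?C" using countable_D A(1) by auto
  moreover have "?C \<subseteq> sets S" using A(2) component_in_mixture by blast
  moreover have "\<Union>?C = space S"
  proof -
    have "\<Union>?C = (\<Union>i\<in>D. \<Union>(A i))" by blast
    also have "\<dots> = space S" unfolding space_mixture by (rule SUP_cong[OF refl A(3)])
    finally show ?thesis .
  qed
  moreover have "\<forall>a\<in>?C. emeasure S a \<noteq> \<infinity>"
  proof
    fix a assume "a \<in> ?C"
    then obtain i where i: "i \<in> D" "a \<in> A i" by blast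
    then have "emeasure S a = emeasure (L i) a"
      using emeasure_mixture_component A(2) by blast
    then show "emeasure S a \<noteq> \<infinity>" using A(4)[OF i] by simp
  qed
  ultimately show "\<exists>A. countable A \<and> A \<subseteq> sets S \<and> \<Union>A = space S \<and> (\<forall>a\<in>A. emeasure S a \<noteq> \<infinity>)"
    by blast
qed

section \<open>Ad-hoc proposals as densities on the mixture\<close>

lemma measurable_lifted_density:
  assumes X: "i \<in> D" and Y: "j \<in> D" and t: "t \<in> L i \<rightarrow>\<^sub>M L j"
    and k: "kernel_density (L j) (L j) k"
  shows "(\<lambda>(s', s). lifted_density (L i) (L j) t k s' s) \<in> borel_measurable (S \<Otimes>\<^sub>M S)"
proof -
  \<comment> \<open>The density is composed with \<open>t\<close> on this rectangle, where both
    coordinates lie in their components; extension by 0 to the whole product preserves measurability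
    since the rectangle is measurable.\<close>
  let ?R = "restrict_space (S \<Otimes>\<^sub>M S) (space (L i) \<times> space (L j))"
  have [measurable]: "space (L i) \<in> sets S" "space (L j) \<in> sets S"
    using assms component_in_mixture by auto
  have "fst \<in> ?R \<rightarrow>\<^sub>M restrict_space S (space (L i))" "snd \<in> ?R \<rightarrow>\<^sub>M restrict_space S (space (L j))"
    by (intro measurable_restrict_space3; auto)+
  then have [measurable]: "fst \<in> ?R \<rightarrow>\<^sub>M L i" "snd \<in> ?R \<rightarrow>\<^sub>M L j"
    by (simp_all add: restrict_mixture X Y)
  note [measurable] = t
  have kj: "(\<lambda>(x, y). k x y) \<in> borel_measurable (L j \<Otimes>\<^sub>M L j)"
    using k by (simp add: kernel_density_def)
  have "(\<lambda>x. (t (fst x), snd x)) \<in> ?R \<rightarrow>\<^sub>M L j \<Otimes>\<^sub>M L j" by measurable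
  from measurable_compose[OF this kj]
  have "(\<lambda>x. k (t (fst x)) (snd x)) \<in> borel_measurable ?R" by simp
  then have "(\<lambda>x. if x \<in> space (L i) \<times> space (L j) then k (t (fst x)) (snd x) else 0)
      \<in> borel_measurable (S \<Otimes>\<^sub>M S)"
    by (subst (asm) measurable_restrict_space_iff[of _ _ 0]) auto
  then show ?thesis
    by (rule measurable_cong[THEN iffD1, rotated]) (auto simp: lifted_density_def split: if_splits)
qed

text \<open>For \<open>s'\<close> in the source space, \<open>t s'\<close> lies in the target space,
  where \<open>k\<close> is normalised; elsewhere the lifted density vanishes.\<close>

lemma nn_integral_lifted_density:
  assumes "i \<in> D" "j \<in> D" "t \<in> L i \<rightarrow>\<^sub>M L j" "kernel_density (L j) (L j) k"
  shows "(\<integral>\<^sup>+ s. ennreal (lifted_density (L i) (L j) t k s' s) \<partial>S) = indicator (space (L i)) s'"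
proof -
  have "(\<integral>\<^sup>+ s. ennreal (lifted_density (L i) (L j) t k s' s) \<partial>S)
      = (\<integral>\<^sup>+ s. ennreal (lifted_density (L i) (L j) t k s' s) \<partial>L j)"
    unfolding nn_integral_component[OF assms(2)]
    by (intro nn_integral_cong) (auto simp: lifted_density_def indicator_def)
  also have "\<dots> = (\<integral>\<^sup>+ s. indicator (space (L i)) s' * ennreal (k (t s') s) \<partial>L j)"
    by (intro nn_integral_cong) (auto simp: lifted_density_def indicator_def)
  also have "\<dots> = indicator (space (L i)) s'"
    using assms(4) measurable_space[OF assms(3)]
    by (cases "s' \<in> space (L i)") (auto simp: kernel_density_def)
  finally show ?thesis .
qed

text \<open>The lifted density is 0 off \<open>space (L j)\<close>, so integrating it over
  \<open>S\<close> or over the component gives the same value.\<close>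

lemma adhoc_proposal_eq_density:
  assumes "i \<in> D" "j \<in> D" "t \<in> L i \<rightarrow>\<^sub>M L j" "kernel_density (L j) (L j) k" "s' \<in> space S"
  shows "adhoc_proposal S (L i) (L j) t k s' =
    density S (\<lambda>s. ennreal (lifted_density (L i) (L j) t k s' s))"
proof -
  let ?f = "lifted_density (L i) (L j) t k s'"
  have f[measurable]: "?f \<in> borel_measurable S"
    using measurable_compose[OF measurable_Pair1'[OF assms(5)] measurable_lifted_density[OF assms(1-4)]]
    by simp
  have fL[measurable]: "?f \<in> borel_measurable (L j)"
    using measurable_restrict_space1[OF f, of "space (L j)"] by (simp add: restrict_mixture assms(2))
  have id: "(\<lambda>s. s) \<in> L j \<rightarrow>\<^sub>M S"
    using measurable_restrict_space1[OF measurable_ident_sets[OF refl], of S "space (L j)"]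
    by (simp add: restrict_mixture assms(2))
  show ?thesis
    unfolding adhoc_proposal_def
  proof (rule measure_eqI; simp)
    fix A assume A: "A \<in> sets S"
    have AL: "A \<inter> space (L j) \<in> sets (L j)" using sets_mixture_Int[OF assms(2) A] .
    have "emeasure (distr (density (L j) (\<lambda>s. ennreal (?f s))) S (\<lambda>s. s)) A
      = emeasure (density (L j) (\<lambda>s. ennreal (?f s))) (A \<inter> space (L j))"
      using A id by (subst emeasure_distr) auto
    also have "\<dots> = (\<integral>\<^sup>+ s. ennreal (?f s) * indicator (A \<inter> space (L j)) s \<partial>L j)"
      using AL by (intro emeasure_density) auto
    also have "\<dots> = (\<integral>\<^sup>+ s. ennreal (?f s) * indicator A s \<partial>S)"
      unfolding nn_integral_component[OF assms(2)]
      by (intro nn_integral_cong) (auto simp: lifted_density_def indicator_def)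
    also have "\<dots> = emeasure (density S (\<lambda>s. ennreal (?f s))) A"
      using A by (intro emeasure_density[symmetric]) auto
    finally show "emeasure (distr (density (L j) (\<lambda>s. ennreal (?f s))) S (\<lambda>s. s)) A =
      emeasure (density S (\<lambda>s. ennreal (?f s))) A" .
  qed
qed

end

text \<open>A move chosen at a point outside its source space proposes the null measure and loses
  its share of mass. Hence the Markov property is stated for move probabilities vanishing there,
  while the subprobability property and detailed balance hold in either case.\<close>

theorem corollary1:
  fixes D :: "'i set" and L :: "'i \<Rightarrow> 'a measure" and S \<pi> :: "'a measure" and p :: "'a \<Rightarrow> real"
    and M :: "'m set" and src tgt :: "'m \<Rightarrow> 'i" and r :: "'m \<Rightarrow> 'm"
    and q :: "'m \<Rightarrow> 'a \<Rightarrow> real" and t :: "'m \<Rightarrow> 'a \<Rightarrow> 'a" and k :: "'m \<Rightarrow> 'a \<Rightarrow> 'a \<Rightarrow> real"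
    and kd :: "'m \<Rightarrow> 'a \<Rightarrow> 'a \<Rightarrow> real" and K :: "'m \<Rightarrow> 'a \<Rightarrow> 'a measure"
    and \<mu> :: "'a \<Rightarrow> 'a measure"
  assumes "countable D"
    and "\<And>i. i \<in> D \<Longrightarrow> sigma_finite_measure (L i)"
    and "disjoint_family_on (\<lambda>i. space (L i)) D"
    and S: "S = mixture_measure D L"
    and "p \<in> borel_measurable S"
    and "\<And>s. s \<in> space S \<Longrightarrow> 0 \<le> p s"
    and \<pi>: "\<pi> = density S (\<lambda>s. ennreal (p s))"
    and "prob_space \<pi>"
    and "countable M"
    and "\<And>l. l \<in> M \<Longrightarrow> src l \<in> D \<and> tgt l \<in> D"
    and "bij_betw r M M"
    and "\<And>l. l \<in> M \<Longrightarrow> src (r l) = tgt l \<and> tgt (r l) = src l"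
    and "\<And>l. l \<in> M \<Longrightarrow> r (r l) = l"
    and "\<And>l. l \<in> M \<Longrightarrow> q l \<in> borel_measurable S"
    and "\<And>l s'. l \<in> M \<Longrightarrow> s' \<in> space S \<Longrightarrow> q l s' \<in> {0..1}"
    and "\<And>s'. s' \<in> space S \<Longrightarrow> ((\<lambda>l. q l s') has_sum 1) M"
    and "\<And>l. l \<in> M \<Longrightarrow> t l \<in> L (src l) \<rightarrow>\<^sub>M L (tgt l)"
    and "\<And>l. l \<in> M \<Longrightarrow> kernel_density (L (tgt l)) (L (tgt l)) (k l)"
    and kd: "kd = (\<lambda>l. lifted_density (L (src l)) (L (tgt l)) (t l) (k l))"
    and K: "K = (\<lambda>l. adhoc_proposal S (L (src l)) (L (tgt l)) (t l) (k l))"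
    and \<mu>: "\<mu> = transition_kernel S M q (acceptance p q r kd) K"
  shows "\<mu> \<in> S \<rightarrow>\<^sub>M subprob_algebra S \<and>
    ((\<forall>l\<in>M. \<forall>s'\<in>space S - space (L (src l)). q l s' = 0) \<longrightarrow> markov_kernel S \<mu>) \<and>
    detailed_balance \<pi> \<mu>"
proof -
  interpret X: countable_mixture D L
    using assms(1-3) by (rule countable_mixture.intro)
  have k_nonneg: "0 \<le> k l x y" if "l \<in> M" "x \<in> space (L (tgt l))" "y \<in> space (L (tgt l))" for l x y
    using assms(18)[OF that(1)] that by (simp add: kernel_density_def)
  have mass: "(\<integral>\<^sup>+ s. ennreal (kd l s' s) \<partial>S) = indicator (space (L (src l))) s'" if "l \<in> M" for l s'
    unfolding kd S using that assms(10,17,18) by (intro X.nn_integral_lifted_density) auto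
  \<comment> \<open>The unnamed facts from here on are assumptions of
    \<open>countable_moves\<close>, picked up by \<open>fact\<close> in the interpretation.\<close>
  have "space S \<noteq> {}"
    using prob_space.not_empty[OF \<open>prob_space \<pi>\<close>] by (simp add: \<pi>)
  have "(\<lambda>(s', s). kd l s' s) \<in> borel_measurable (S \<Otimes>\<^sub>M S)" if "l \<in> M" for l
    unfolding kd S using that assms(10,17,18) by (intro X.measurable_lifted_density) auto
  have "0 \<le> q l s'" if "l \<in> M" "s' \<in> space S" for l s'
    using assms(15)[OF that] by simp
  have "0 \<le> kd l s' s" if "l \<in> M" "s' \<in> space S" "s \<in> space S" for l s' s
    using that(1) k_nonneg measurable_space[OF assms(17)] by (simp add: kd lifted_density_def)
  have "(\<integral>\<^sup>+ s. ennreal (kd l s' s) \<partial>S) \<le> 1" if "l \<in> M" "s' \<in> space S" for l s'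
    using mass[OF that(1)] by (simp add: indicator_def)
  have "sigma_finite_measure S"
    unfolding S by (rule X.sigma_finite_mixture)
  interpret C: countable_moves S p M r q kd
    by (intro countable_moves.intro countable_moves_axioms.intro; fact)
  \<comment> \<open>Agreement on \<open>space S\<close> is enough, since measurability and integrals
    depend only on values there.\<close>
  have eq: "\<mu> s' = C.\<kappa> s'" if "s' \<in> space S" for s'
  proof -
    have "K l s' = density S (\<lambda>s. ennreal (kd l s' s))" if "l \<in> M" for l
      unfolding K kd S using that \<open>s' \<in> space S\<close> assms(10,17,18)
      by (intro X.adhoc_proposal_eq_density) (auto simp: S)
    then show ?thesis
      unfolding \<mu> C.\<kappa>_def transition_kernel_def
      by (intro arg_cong[where f = "measure_of (space S) (sets S)"] ext nn_integral_cong) simp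
  qed
  have "\<mu> \<in> S \<rightarrow>\<^sub>M subprob_algebra S"
    using C.subprob_\<kappa> by (subst measurable_cong[OF eq])
  moreover have "markov_kernel S \<mu>"
    if "\<forall>l\<in>M. \<forall>s'\<in>space S - space (L (src l)). q l s' = 0"
  proof -
    have "markov_kernel S C.\<kappa>"
      using that by (intro C.markov_\<kappa>) (auto simp: mass indicator_def)
    then show ?thesis
      unfolding markov_kernel_def by (subst measurable_cong[OF eq])
  qed
  moreover have "kernel_product \<pi> \<mu> A B = kernel_product \<pi> C.\<kappa> A B" for A B
    unfolding kernel_product_def by (intro nn_integral_cong) (simp add: eq \<pi>)
  then have "detailed_balance \<pi> \<mu>"
    using C.detailed_balance_\<kappa> by (simp add: detailed_balance_def \<pi>)
  ultimately show ?thesis by blast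
qed

end
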